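(* Assume that the linear system $\dot x=L(t)x$ is exponentially stable and that the bounded set $U\subset\mathbb{R}^d$ (containing the origin) is symmetric with respect to the origin, i.e. $-U=U$. Then, for every $t\in\mathbb{R}$, the set $$A_t=\Big\{\rho\int_{-\infty}^t\Psi(t,s)\xi(s)\,ds : \xi\in L^\infty(\mathbb{R},\mathbb{R}^d),\ \xi(s)\in U\text{ for a.e. }s\in\mathbb{R}\Big\}$$ is symmetric with respect to the origin.
   Context: Let $d\ge2$, $\rho>0$, and $L:\mathbb{R}\to\mathbb{R}^{d\times d}$ locally integrable. $\Psi(t,s)$ is the principal matrix solution of $\dot x=L(t)x$ at $s$ (i.e. $\Psi(s,s)=I$). Exponential stability means: there are $K\ge1$, $\gamma>0$ with $\|\Psi(t,s)\|\le Ke^{-\gamma(t-s)}$ for all $t\ge s$. *)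

theory Defs
  imports "HOL-Analysis.Analysis"
begin

(* HOL-Analysis has no notion of an absolutely continuous function; this is the usual
   epsilon-delta definition. Here "d division_of T" says that d is a finite family of nonempty compact
   intervals with pairwise disjoint interiors and union T. *)
definition abs_continuous_on :: "real set \<Rightarrow> (real \<Rightarrow> 'a::real_normed_vector) \<Rightarrow> bool" where
  "abs_continuous_on S f \<longleftrightarrow>
     (\<forall>\<epsilon>>0. \<exists>\<delta>>0. \<forall>d T. d division_of T \<and> T \<subseteq> S \<and> (\<Sum>k\<in>d. Sup k - Inf k) < \<delta> \<longrightarrow>
        (\<Sum>k\<in>d. norm (f (Sup k) - f (Inf k))) < \<epsilon>)"

definition locally_integrable :: "(real \<Rightarrow> 'a::euclidean_space) \<Rightarrow> bool" where
  "locally_integrable f \<longleftrightarrow> (\<forall>a b. f absolutely_integrable_on {a..b})"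

(* L is only locally integrable, so solutions are meant in the sense of Caratheodory: locally
   absolutely continuous functions that satisfy the equation almost everywhere. *)
definition principal_matrix_solution ::
    "(real \<Rightarrow> real^'n^'n) \<Rightarrow> (real \<Rightarrow> real \<Rightarrow> real^'n^'n) \<Rightarrow> bool" where
  "principal_matrix_solution L \<Psi> \<longleftrightarrow>
     (\<forall>s. \<Psi> s s = mat 1 \<and>
          (\<forall>a b. abs_continuous_on {a..b} (\<lambda>t. \<Psi> t s)) \<and>
          (AE t in lebesgue. ((\<lambda>t. \<Psi> t s) has_vector_derivative L t ** \<Psi> t s) (at t)))"

(* The matrix norm is the operator norm induced by the Euclidean norm; another choice of norm would
   only change the constant K. *)
definition exponentially_stable :: "(real \<Rightarrow> real \<Rightarrow> real^'n^'n) \<Rightarrow> bool" where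
  "exponentially_stable \<Psi> \<longleftrightarrow>
     (\<exists>K\<ge>1. \<exists>\<gamma>>0. \<forall>t s. s \<le> t \<longrightarrow> onorm ((*v) (\<Psi> t s)) \<le> K * exp (- \<gamma> * (t - s)))"

(* Representatives, rather than classes modulo equality almost everywhere. *)
definition L_infinity :: "(real \<Rightarrow> 'a::euclidean_space) set" where
  "L_infinity = {\<xi> \<in> borel_measurable lebesgue. \<exists>C. AE s in lebesgue. norm (\<xi> s) \<le> C}"

(* When \<Psi> is the principal matrix solution of an exponentially stable system, the integrand is
   integrable over {..t} for every such \<xi>, so the default value 0 of the Bochner integral of a
   non-integrable function plays no role. *)
definition fiber ::
    "(real \<Rightarrow> real \<Rightarrow> real^'n^'n) \<Rightarrow> real \<Rightarrow> (real^'n) set \<Rightarrow> real \<Rightarrow> (real^'n) set" where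
  "fiber \<Psi> \<rho> U t =
     {\<rho> *\<^sub>R (LINT s:{..t}|lebesgue. \<Psi> t s *v \<xi> s) | \<xi>.
        \<xi> \<in> L_infinity \<and> (AE s in lebesgue. \<xi> s \<in> U)}"

end

theory Submission
  imports Defs
begin

text \<open>The integral depends linearly on the control \<xi>, so replacing \<xi> by -\<xi> negates
  the corresponding point of A_t. The control -\<xi> is again admissible: negation preserves
  measurability and the essential bound, and the symmetry of U keeps the values in U almost
  everywhere. Hence A_t is closed under negation (\<open>uminus_mem_fiber\<close>); as negation is
  an involution, this closure already gives equality of the two sets.\<close>

lemma uminus_mem_fiber:
  fixes \<Psi> :: "real \<Rightarrow> real \<Rightarrow> real^'n^'n"
  assumes "uminus ` U = U" and "x \<in> fiber \<Psi> \<rho> U t"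
  shows "- x \<in> fiber \<Psi> \<rho> U t"
proof -
  from assms(2) obtain \<xi> where x: "x = \<rho> *\<^sub>R (LINT s:{..t}|lebesgue. \<Psi> t s *v \<xi> s)"
    and \<xi>: "\<xi> \<in> L_infinity" and U: "AE s in lebesgue. \<xi> s \<in> U"
    unfolding fiber_def by blast
  \<comment> \<open>The Bochner integral commutes with negation unconditionally: if one integrand is
    not integrable, neither is the other, and both integrals take the default value 0.\<close>
  have "(LINT s:{..t}|lebesgue. \<Psi> t s *v (- \<xi> s)) = - (LINT s:{..t}|lebesgue. \<Psi> t s *v \<xi> s)"
    by (simp add: set_lebesgue_integral_def vec.neg)
  then have "- x = \<rho> *\<^sub>R (LINT s:{..t}|lebesgue. \<Psi> t s *v (- \<xi> s))"
    by (simp add: x)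
  moreover have "(\<lambda>s. - \<xi> s) \<in> L_infinity"
    using \<xi> by (auto simp: L_infinity_def)
  moreover have "AE s in lebesgue. - \<xi> s \<in> U"
    using U by eventually_elim (use assms(1) in blast)
  ultimately show ?thesis
    unfolding fiber_def by (intro CollectI exI[of _ "\<lambda>s. - \<xi> s"] conjI)
qed

theorem corollary4p4:
  fixes L :: "real \<Rightarrow> real^'n^'n"
    and \<Psi> :: "real \<Rightarrow> real \<Rightarrow> real^'n^'n"
    and \<rho> :: real
    and U :: "(real^'n) set"
  assumes "CARD('n) \<ge> 2"
    and "\<rho> > 0"
    and "locally_integrable L"
    and "principal_matrix_solution L \<Psi>"
    and "exponentially_stable \<Psi>"
    and "bounded U"
    and "0 \<in> U"
    and "uminus ` U = U"
  shows "\<forall>t. uminus ` fiber \<Psi> \<rho> U t = fiber \<Psi> \<rho> U t"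
proof (intro allI equalityI subsetI)
  fix t x
  assume "x \<in> uminus ` fiber \<Psi> \<rho> U t"
  then show "x \<in> fiber \<Psi> \<rho> U t"
    using uminus_mem_fiber[OF assms(8)] by blast
next
  fix t x
  assume "x \<in> fiber \<Psi> \<rho> U t"
  \<comment> \<open>The preimage of x under negation is -x itself, so the same closure property
    yields this inclusion.\<close>
  then have "- x \<in> fiber \<Psi> \<rho> U t"
    by (rule uminus_mem_fiber[OF assms(8)])
  then show "x \<in> uminus ` fiber \<Psi> \<rho> U t"
    by (rule rev_image_eqI) simp
qed

end
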